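(* Let $p$ be a prime and $1\le q\le\infty$. Every locally constant, compactly supported function $\phi\in L_q(\mathbb{Q}_p)$ is infinitely smooth, i.e. $\phi\in Lip(\alpha,L_q(\mathbb{Q}_p))$ for every $\alpha>0$ (equivalently, its critical exponent is $\nu_q(\phi)=+\infty$).
   Context: $\mathbb{Q}_p$ is the field of $p$-adic numbers with norm $|\cdot|_p$ and Haar measure, and $B_\gamma(0)=\{x\in\mathbb{Q}_p:|x|_p\le p^\gamma\}$ for $\gamma\in\mathbb{Z}$. Functions are complex-valued. For $f\in L_q(\mathbb{Q}_p)$ and $n\in\mathbb{N}$, the modulus of continuity is $\omega_q(f,n)=\sup\{\|f-f(\cdot-h)\|_q:h\in B_{-n}(0)\}$. A function $f$ belongs to the Lipschitz space $Lip(\alpha,L_q(\mathbb{Q}_p))$ if $f\in L_q(\mathbb{Q}_p)$ and there is a constant $c=c(f)>0$ with $\omega_q(f,n)\le c\,p^{-\alpha n}$ for all $n\in\mathbb{N}$. The critical exponent (optimal smoothness) of $f$ in the $L_q$-norm is $\nu_q(f)=\sup\{\nu: f\in Lip(\nu,L_q(\mathbb{Q}_p))\}$. *)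

theory Defs
  imports
    "HOL-Computational_Algebra.Squarefree"
    "HOL-Probability.Probability"
    "Berlekamp_Zassenhaus.Finite_Field"
begin

section \<open>The \<open>p\<close>-adic absolute value on the rationals\<close>

definition rat_padic_val :: "nat \<Rightarrow> rat \<Rightarrow> int" where
  "rat_padic_val p r =
     int (multiplicity (int p) (fst (quotient_of r))) - int (multiplicity (int p) (snd (quotient_of r)))"

definition rat_padic_abs :: "nat \<Rightarrow> rat \<Rightarrow> real" where
  "rat_padic_abs p r = (if r = 0 then 0 else real p powi (- rat_padic_val p r))"

definition padic_cauchy :: "nat \<Rightarrow> (nat \<Rightarrow> rat) \<Rightarrow> bool" where
  "padic_cauchy p X \<longleftrightarrow> (\<forall>e>0. \<exists>N. \<forall>m\<ge>N. \<forall>n\<ge>N. rat_padic_abs p (X m - X n) < e)"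

definition padic_null :: "nat \<Rightarrow> (nat \<Rightarrow> rat) \<Rightarrow> bool" where
  "padic_null p X \<longleftrightarrow> (\<lambda>n. rat_padic_abs p (X n)) \<longlonglongrightarrow> 0"

lemma rat_padic_abs_0 [simp]: "rat_padic_abs p 0 = 0"
  by (simp add: rat_padic_abs_def)

lemma rat_padic_abs_1 [simp]: "rat_padic_abs p 1 = 1"
  by (simp add: rat_padic_abs_def rat_padic_val_def)

lemma rat_padic_abs_minus [simp]: "rat_padic_abs p (- r) = rat_padic_abs p r"
  by (simp add: rat_padic_abs_def rat_padic_val_def rat_uminus_code Let_def multiplicity_uminus_right split: prod.split)

lemma rat_padic_abs_commute: "rat_padic_abs p (r - s) = rat_padic_abs p (s - r)"
  using rat_padic_abs_minus[of p "r - s"] by simp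

lemma rat_padic_abs_nonneg [simp]: "0 \<le> rat_padic_abs p r"
  by (simp add: rat_padic_abs_def)

context
  fixes p :: nat
  assumes p: "prime p"
begin

lemma rat_padic_abs_eq_0_iff [simp]: "rat_padic_abs p r = 0 \<longleftrightarrow> r = 0"
  using prime_gt_0_nat[OF p] by (simp add: rat_padic_abs_def)

lemma rat_padic_val_divide:
  fixes a b :: int
  assumes "a \<noteq> 0" "b \<noteq> 0"
  shows "rat_padic_val p (of_int a / of_int b) =
           int (multiplicity (int p) a) - int (multiplicity (int p) b)"
proof -
  obtain c d where cd: "quotient_of (of_int a / of_int b) = (c, d)"
    by force
  have d: "d > 0" and eq: "(of_int a / of_int b :: rat) = of_int c / of_int d"
    using quotient_of_denom_pos[OF cd] quotient_of_div[OF cd] by auto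
  have "(of_int (a * d) :: rat) = of_int (c * b)"
    using eq d assms by (simp add: field_simps)
  then have ad: "a * d = c * b"
    by linarith
  then have c: "c \<noteq> 0" using assms d by auto
  have "prime_elem (int p)" using p by simp
  then have "multiplicity (int p) a + multiplicity (int p) d = multiplicity (int p) c + multiplicity (int p) b"
    using ad assms c d by (metis prime_elem_multiplicity_mult_distrib less_irrefl)
  then show ?thesis by (simp add: rat_padic_val_def cd)
qed

lemma rat_padic_abs_mult: "rat_padic_abs p (r * s) = rat_padic_abs p r * rat_padic_abs p s"
proof (cases "r = 0 \<or> s = 0")
  case False
  obtain a b where r: "quotient_of r = (a, b)" by force
  obtain c d where s: "quotient_of s = (c, d)" by force
  have b: "b > 0" "d > 0" using quotient_of_denom_pos r s by auto
  have rs: "r = of_int a / of_int b" "s = of_int c / of_int d"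
    using quotient_of_div r s by auto
  have a: "a \<noteq> 0" "c \<noteq> 0" using rs False by auto
  have pe: "prime_elem (int p)" using p by simp
  have "rat_padic_val p (r * s) = rat_padic_val p (of_int (a * c) / of_int (b * d))"
    by (simp add: rs)
  also have "\<dots> = rat_padic_val p r + rat_padic_val p s"
    unfolding rs using a b
    by (simp add: rat_padic_val_divide prime_elem_multiplicity_mult_distrib[OF pe] del: of_int_mult)
  finally show ?thesis
    using False prime_gt_0_nat[OF p] by (simp add: rat_padic_abs_def power_int_add power_int_diff power_int_minus field_simps)
qed auto

lemma rat_padic_abs_inverse: "rat_padic_abs p (inverse r) = inverse (rat_padic_abs p r)"
proof (cases "r = 0")
  case False
  then have "rat_padic_abs p (inverse r) * rat_padic_abs p r = 1"
    by (simp flip: rat_padic_abs_mult)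
  then show ?thesis
    by (metis inverse_unique mult.commute)
qed auto

lemma rat_padic_abs_ultrametric:
  "rat_padic_abs p (r + s) \<le> max (rat_padic_abs p r) (rat_padic_abs p s)"
proof (cases "r = 0 \<or> s = 0 \<or> r + s = 0")
  case True
  then show ?thesis by (auto simp: le_max_iff_disj)
next
  case False
  obtain a b where r: "quotient_of r = (a, b)" by force
  obtain c d where s: "quotient_of s = (c, d)" by force
  have b: "b > 0" "d > 0" using quotient_of_denom_pos r s by auto
  have r': "r = of_int (a * d) / of_int (b * d)" and s': "s = of_int (c * b) / of_int (b * d)"
    using quotient_of_div[OF r] quotient_of_div[OF s] b by auto
  have rs: "r + s = of_int (a * d + c * b) / of_int (b * d)"
    unfolding r' s' by (simp add: add_divide_distrib)
  let ?m = "multiplicity (int p)"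
  have nz: "a * d \<noteq> 0" "c * b \<noteq> 0" "b * d \<noteq> 0" "a * d + c * b \<noteq> 0"
    using False r' s' b by auto (metis rs div_0 of_int_0)
  have p1: "int p > 1" using prime_gt_1_nat[OF p] by simp
  have "int p ^ min (?m (a * d)) (?m (c * b)) dvd a * d + c * b"
    by (intro dvd_add) (meson dvd_trans le_imp_power_dvd min.cobounded1 min.cobounded2 multiplicity_dvd)+
  then have "min (?m (a * d)) (?m (c * b)) \<le> ?m (a * d + c * b)"
    using nz p1 by (intro multiplicity_geI) auto
  then have "min (rat_padic_val p r) (rat_padic_val p s) \<le> rat_padic_val p (r + s)"
    unfolding rs unfolding r' s' rat_padic_val_divide[OF nz(1,3)] rat_padic_val_divide[OF nz(2,3)]
      rat_padic_val_divide[OF nz(4,3)] by linarith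
  then have "rat_padic_val p r \<le> rat_padic_val p (r + s) \<or> rat_padic_val p s \<le> rat_padic_val p (r + s)"
    by linarith
  moreover have "real p powi (- j) \<le> real p powi (- i)" if "i \<le> j" for i j
    using that p1 by (intro power_int_increasing) auto
  ultimately show ?thesis
    using False by (auto simp: rat_padic_abs_def le_max_iff_disj)
qed

lemma rat_padic_abs_triangle: "rat_padic_abs p (r + s) \<le> rat_padic_abs p r + rat_padic_abs p s"
  using rat_padic_abs_ultrametric[of r s] rat_padic_abs_nonneg[of p r] rat_padic_abs_nonneg[of p s]
  by linarith

lemma rat_padic_abs_triangle_diff: "\<bar>rat_padic_abs p r - rat_padic_abs p s\<bar> \<le> rat_padic_abs p (r - s)"
  using rat_padic_abs_triangle[of "r - s" s] rat_padic_abs_triangle[of "s - r" r]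
    rat_padic_abs_commute[of p r s] by simp

section \<open>Cauchy and null sequences of rationals\<close>

lemma padic_null_const [simp]: "padic_null p (\<lambda>n. c) \<longleftrightarrow> c = 0"
  by (simp add: padic_null_def LIMSEQ_const_iff)

lemma padic_null_minus: "padic_null p X \<Longrightarrow> padic_null p (\<lambda>n. - X n)"
  by (simp add: padic_null_def)

lemma padic_null_bound:
  assumes "eventually (\<lambda>n. rat_padic_abs p (X n) \<le> B n) sequentially" "B \<longlonglongrightarrow> 0"
  shows "padic_null p X"
  unfolding padic_null_def
  by (rule tendsto_sandwich[OF _ assms(1) tendsto_const assms(2)]) simp

lemma padic_null_add: "padic_null p X \<Longrightarrow> padic_null p Y \<Longrightarrow> padic_null p (\<lambda>n. X n + Y n)"
  by (rule padic_null_bound[where B = "\<lambda>n. rat_padic_abs p (X n) + rat_padic_abs p (Y n)"])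
    (auto simp: padic_null_def rat_padic_abs_triangle intro: tendsto_add_zero)

lemma padic_null_diff: "padic_null p X \<Longrightarrow> padic_null p Y \<Longrightarrow> padic_null p (\<lambda>n. X n - Y n)"
  using padic_null_add[of X "\<lambda>n. - Y n"] padic_null_minus[of Y] by simp

lemma padic_cauchy_const [simp]: "padic_cauchy p (\<lambda>n. c)"
  by (auto simp: padic_cauchy_def)

lemma padic_cauchy_minus [simp]: "padic_cauchy p X \<Longrightarrow> padic_cauchy p (\<lambda>n. - X n)"
  unfolding padic_cauchy_def by (metis minus_diff_minus rat_padic_abs_minus)

lemma padic_cauchy_add [simp]:
  assumes "padic_cauchy p X" "padic_cauchy p Y"
  shows "padic_cauchy p (\<lambda>n. X n + Y n)"
  unfolding padic_cauchy_def
proof (intro allI impI)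
  fix e :: real assume e: "e > 0"
  obtain M where M: "\<And>m n. m \<ge> M \<Longrightarrow> n \<ge> M \<Longrightarrow> rat_padic_abs p (X m - X n) < e"
    using assms(1) e unfolding padic_cauchy_def by meson
  obtain N where N: "\<And>m n. m \<ge> N \<Longrightarrow> n \<ge> N \<Longrightarrow> rat_padic_abs p (Y m - Y n) < e"
    using assms(2) e unfolding padic_cauchy_def by meson
  have "rat_padic_abs p (X m + Y m - (X n + Y n)) < e" if "m \<ge> max M N" "n \<ge> max M N" for m n
    using rat_padic_abs_ultrametric[of "X m - X n" "Y m - Y n"] M[of m n] N[of m n] that
    by (simp add: add_diff_add)
  then show "\<exists>N. \<forall>m\<ge>N. \<forall>n\<ge>N. rat_padic_abs p (X m + Y m - (X n + Y n)) < e"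
    by blast
qed

lemma padic_cauchy_diff [simp]: "padic_cauchy p X \<Longrightarrow> padic_cauchy p Y \<Longrightarrow> padic_cauchy p (\<lambda>n. X n - Y n)"
  using padic_cauchy_add[of X "\<lambda>n. - Y n"] by simp

lemma padic_cauchy_abs_convergent:
  assumes "padic_cauchy p X"
  shows "convergent (\<lambda>n. rat_padic_abs p (X n))"
proof -
  have "Cauchy (\<lambda>n. rat_padic_abs p (X n))"
    unfolding Cauchy_def dist_real_def
    using assms rat_padic_abs_triangle_diff unfolding padic_cauchy_def by (meson le_less_trans)
  then show ?thesis by (simp add: Cauchy_convergent_iff)
qed

lemma padic_cauchy_bounded:
  assumes "padic_cauchy p X"
  obtains B where "B > 0" "\<And>n. rat_padic_abs p (X n) \<le> B"
proof -
  have "Bseq (\<lambda>n. rat_padic_abs p (X n))"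
    using padic_cauchy_abs_convergent[OF assms] by (rule convergent_imp_Bseq)
  then show thesis using that by (auto elim!: BseqE)
qed

lemma padic_null_mult_bounded:
  assumes "padic_cauchy p X" "padic_null p Y"
  shows "padic_null p (\<lambda>n. X n * Y n)"
proof -
  obtain B where B: "B > 0" "\<And>n. rat_padic_abs p (X n) \<le> B"
    using padic_cauchy_bounded[OF assms(1)] by blast
  show ?thesis
    using assms(2)
    by (intro padic_null_bound[where B = "\<lambda>n. B * rat_padic_abs p (Y n)"])
      (auto simp: padic_null_def rat_padic_abs_mult B intro!: always_eventually mult_right_mono tendsto_mult_right_zero)
qed

lemma padic_cauchy_mult [simp]:
  assumes "padic_cauchy p X" "padic_cauchy p Y"
  shows "padic_cauchy p (\<lambda>n. X n * Y n)"
  unfolding padic_cauchy_def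
proof (intro allI impI)
  fix e :: real assume e: "e > 0"
  obtain A where A: "A > 0" "\<And>n. rat_padic_abs p (X n) \<le> A"
    using padic_cauchy_bounded[OF assms(1)] by blast
  obtain B where B: "B > 0" "\<And>n. rat_padic_abs p (Y n) \<le> B"
    using padic_cauchy_bounded[OF assms(2)] by blast
  have "e / B > 0" "e / A > 0" using e A B by auto
  obtain M where M: "\<And>m n. m \<ge> M \<Longrightarrow> n \<ge> M \<Longrightarrow> rat_padic_abs p (X m - X n) < e / B"
    using assms(1) \<open>e / B > 0\<close> unfolding padic_cauchy_def by meson
  obtain N where N: "\<And>m n. m \<ge> N \<Longrightarrow> n \<ge> N \<Longrightarrow> rat_padic_abs p (Y m - Y n) < e / A"
    using assms(2) \<open>e / A > 0\<close> unfolding padic_cauchy_def by meson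
  have "rat_padic_abs p (X m * Y m - X n * Y n) < e" if "m \<ge> max M N" "n \<ge> max M N" for m n
  proof -
    have "rat_padic_abs p (X m) * rat_padic_abs p (Y m - Y n) \<le> A * rat_padic_abs p (Y m - Y n)"
      using A by (intro mult_right_mono) auto
    also have "\<dots> < e" using N[of m n] that A by (simp add: field_simps)
    finally have 1: "rat_padic_abs p (X m * (Y m - Y n)) < e" by (simp add: rat_padic_abs_mult)
    have "rat_padic_abs p (X m - X n) * rat_padic_abs p (Y n) \<le> rat_padic_abs p (X m - X n) * B"
      using B by (intro mult_left_mono) auto
    also have "\<dots> < e" using M[of m n] that B by (simp add: field_simps)
    finally have 2: "rat_padic_abs p ((X m - X n) * Y n) < e" by (simp add: rat_padic_abs_mult)
    show ?thesis
      using rat_padic_abs_ultrametric[of "X m * (Y m - Y n)" "(X m - X n) * Y n"] 1 2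
      by (simp add: mult_diff_mult)
  qed
  then show "\<exists>N. \<forall>m\<ge>N. \<forall>n\<ge>N. rat_padic_abs p (X m * Y m - X n * Y n) < e"
    by blast
qed

lemma padic_cauchy_not_null:
  assumes "padic_cauchy p X" "\<not> padic_null p X"
  obtains b where "b > 0" "eventually (\<lambda>n. b < rat_padic_abs p (X n)) sequentially"
proof -
  obtain L where L: "(\<lambda>n. rat_padic_abs p (X n)) \<longlonglongrightarrow> L"
    using padic_cauchy_abs_convergent[OF assms(1)] unfolding convergent_def by blast
  have "L \<ge> 0" by (rule LIMSEQ_le_const[OF L]) auto
  then have "L > 0" using L assms(2) unfolding padic_null_def by (cases "L = 0") auto
  then show thesis
    using that[of "L / 2"] order_tendstoD(1)[OF L, of "L / 2"] by auto
qed

lemma padic_cauchy_inverse: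
  assumes "padic_cauchy p X" "\<not> padic_null p X"
  shows "padic_cauchy p (\<lambda>n. inverse (X n))"
  unfolding padic_cauchy_def
proof (intro allI impI)
  fix e :: real assume e: "e > 0"
  obtain b N where b: "b > 0" and N: "\<And>n. n \<ge> N \<Longrightarrow> b < rat_padic_abs p (X n)"
    using padic_cauchy_not_null[OF assms] unfolding eventually_sequentially by metis
  have "e * b * b > 0" using e b by simp
  then obtain M where M: "\<And>m n. m \<ge> M \<Longrightarrow> n \<ge> M \<Longrightarrow> rat_padic_abs p (X m - X n) < e * b * b"
    using assms(1) unfolding padic_cauchy_def by meson
  have "rat_padic_abs p (inverse (X m) - inverse (X n)) < e" if mn: "m \<ge> max M N" "n \<ge> max M N" for m n
  proof -
    have bm: "b < rat_padic_abs p (X m)" "b < rat_padic_abs p (X n)" using N mn by auto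
    then have nz: "X m \<noteq> 0" "X n \<noteq> 0" using b by auto
    have "rat_padic_abs p (inverse (X m) - inverse (X n)) =
        rat_padic_abs p (X m - X n) / (rat_padic_abs p (X m) * rat_padic_abs p (X n))"
      unfolding inverse_diff_inverse[OF nz] rat_padic_abs_minus rat_padic_abs_mult rat_padic_abs_inverse
      by (simp add: divide_inverse mult_ac)
    also have "\<dots> \<le> rat_padic_abs p (X m - X n) / (b * b)"
      using bm b by (intro divide_left_mono mult_mono mult_pos_pos) auto
    also have "\<dots> < e" using M[of m n] mn b by (simp add: field_simps)
    finally show ?thesis .
  qed
  then show "\<exists>N. \<forall>m\<ge>N. \<forall>n\<ge>N. rat_padic_abs p (inverse (X m) - inverse (X n)) < e"
    by blast
qed

lemma padic_null_inverse_mult: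
  assumes "padic_cauchy p X" "\<not> padic_null p X"
  shows "padic_null p (\<lambda>n. inverse (X n) * X n - 1)"
proof -
  obtain b where b: "b > 0" "eventually (\<lambda>n. b < rat_padic_abs p (X n)) sequentially"
    using padic_cauchy_not_null[OF assms] by blast
  have "eventually (\<lambda>n. rat_padic_abs p (inverse (X n) * X n - 1) \<le> 0) sequentially"
    using b(2) by eventually_elim (use b(1) in \<open>auto simp: rat_padic_abs_def split: if_splits\<close>)
  then show ?thesis by (rule padic_null_bound) simp
qed

lemma padic_null_diff_inverse:
  assumes X: "padic_cauchy p X" "\<not> padic_null p X"
    and Y: "padic_cauchy p Y" "\<not> padic_null p Y"
    and XY: "padic_null p (\<lambda>n. X n - Y n)"
  shows "padic_null p (\<lambda>n. inverse (X n) - inverse (Y n))"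
proof -
  let ?I = "\<lambda>X n. inverse (X n)"
  have I: "padic_cauchy p (?I X)" "padic_cauchy p (?I Y)"
    using X Y by (auto intro: padic_cauchy_inverse)
  have 1: "padic_null p (\<lambda>n. ?I X n * (?I Y n * (X n - Y n)))"
    by (intro padic_null_mult_bounded I XY)
  obtain b where b: "b > 0" "eventually (\<lambda>n. b < rat_padic_abs p (X n)) sequentially"
    using padic_cauchy_not_null[OF X] by blast
  obtain c where c: "c > 0" "eventually (\<lambda>n. c < rat_padic_abs p (Y n)) sequentially"
    using padic_cauchy_not_null[OF Y] by blast
  have "eventually (\<lambda>n. rat_padic_abs p (?I X n - ?I Y n) \<le>
      rat_padic_abs p (?I X n * (?I Y n * (X n - Y n)))) sequentially"
    using b(2) c(2)
  proof eventually_elim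
    case (elim n)
    then have "X n \<noteq> 0" "Y n \<noteq> 0" using b(1) c(1) by auto
    then have "?I X n - ?I Y n = - (?I X n * (?I Y n * (X n - Y n)))"
      by (simp add: field_simps)
    then show ?case by (metis rat_padic_abs_minus order_refl)
  qed
  then show ?thesis
    by (rule padic_null_bound) (use 1 in \<open>simp add: padic_null_def\<close>)
qed

end

section \<open>The field of \<open>p\<close>-adic numbers\<close>

text \<open>The prime is \<open>p = CARD('p)\<close>; the field is the completion of the rationals with respect to the
  \<open>p\<close>-adic absolute value, built from Cauchy sequences modulo null sequences.\<close>

definition padic_rel :: "'p::prime_card itself \<Rightarrow> ((nat \<Rightarrow> rat) \<times> (nat \<Rightarrow> rat)) set" where
  "padic_rel _ = {(X, Y). padic_cauchy CARD('p) X \<and> padic_cauchy CARD('p) Y \<and>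
     padic_null CARD('p) (\<lambda>n. X n - Y n)}"

typedef (overloaded) 'p padic =
  "{X. padic_cauchy CARD('p::prime_card) X} // padic_rel TYPE('p)"
  by (rule exI, rule quotientI, rule CollectI, rule padic_cauchy_const[OF prime_card])

definition Padic :: "(nat \<Rightarrow> rat) \<Rightarrow> 'p::prime_card padic" where
  "Padic X = Abs_padic (padic_rel TYPE('p) `` {X})"

definition padic_seq :: "'p::prime_card padic \<Rightarrow> nat \<Rightarrow> rat" where
  "padic_seq x = (SOME X. X \<in> Rep_padic x)"

lemmas padic_seq_simps [simp] =
  padic_null_const[OF prime_card] padic_cauchy_const[OF prime_card] padic_cauchy_minus[OF prime_card]
  padic_cauchy_add[OF prime_card] padic_cauchy_diff[OF prime_card] padic_cauchy_mult[OF prime_card]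

lemma equiv_padic_rel: "equiv {X. padic_cauchy CARD('p) X} (padic_rel TYPE('p::prime_card))"
proof (rule equivI)
  show "refl_on {X. padic_cauchy CARD('p) X} (padic_rel TYPE('p))"
    by (auto simp: refl_on_def padic_rel_def)
  show "sym (padic_rel TYPE('p))"
    by (auto simp: sym_def padic_rel_def padic_null_def rat_padic_abs_commute)
  show "trans (padic_rel TYPE('p))"
    unfolding padic_rel_def
    by (rule transI) (force dest: padic_null_add[OF prime_card])
qed (auto simp: padic_rel_def)

lemma Padic_eq_iff:
  fixes X Y :: "nat \<Rightarrow> rat"
  assumes "padic_cauchy CARD('p) X" "padic_cauchy CARD('p) Y"
  shows "(Padic X :: 'p::prime_card padic) = Padic Y \<longleftrightarrow> padic_null CARD('p) (\<lambda>n. X n - Y n)"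
proof -
  have "(Padic X :: 'p padic) = Padic Y \<longleftrightarrow> padic_rel TYPE('p) `` {X} = padic_rel TYPE('p) `` {Y}"
    unfolding Padic_def using assms by (intro Abs_padic_inject) (auto intro: quotientI)
  also have "\<dots> \<longleftrightarrow> (X, Y) \<in> padic_rel TYPE('p)"
    using assms by (intro eq_equiv_class_iff[OF equiv_padic_rel]) auto
  finally show ?thesis using assms by (simp add: padic_rel_def)
qed

lemma padic_seq:
  fixes x :: "'p::prime_card padic"
  shows padic_seq_cauchy [simp]: "padic_cauchy CARD('p) (padic_seq x)"
    and Padic_padic_seq [simp]: "Padic (padic_seq x) = x"
proof -
  obtain X where X: "padic_cauchy CARD('p) X" "Rep_padic x = padic_rel TYPE('p) `` {X}"
    using Rep_padic[of x] by (auto elim!: quotientE)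
  have "X \<in> Rep_padic x" using X by (auto simp: padic_rel_def)
  then have "padic_seq x \<in> Rep_padic x" unfolding padic_seq_def by (rule someI[where P = "\<lambda>X. X \<in> Rep_padic x"])
  then have r: "(X, padic_seq x) \<in> padic_rel TYPE('p)" using X by auto
  then show *: "padic_cauchy CARD('p) (padic_seq x)" by (auto simp: padic_rel_def)
  have "x = Padic X" unfolding Padic_def X(2)[symmetric] by (simp add: Rep_padic_inverse)
  also have "\<dots> = Padic (padic_seq x)" using r by (auto simp: Padic_eq_iff X * padic_rel_def)
  finally show "Padic (padic_seq x) = x" ..
qed

lemma padic_cases [cases type: padic]:
  fixes x :: "'p::prime_card padic"
  obtains X where "x = Padic X" "padic_cauchy CARD('p) X"
  using padic_seq[of x] by metis

lemma padic_null_seq_Padic: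
  assumes "padic_cauchy CARD('p) X"
  shows "padic_null CARD('p) (\<lambda>n. padic_seq (Padic X :: 'p::prime_card padic) n - X n)"
  using Padic_eq_iff[of "padic_seq (Padic X :: 'p padic)" X, where 'p = 'p] assms by simp

instantiation padic :: (prime_card) field
begin

definition zero_padic :: "'a padic" where "0 = Padic (\<lambda>n. 0)"
definition one_padic :: "'a padic" where "1 = Padic (\<lambda>n. 1)"
definition plus_padic :: "'a padic \<Rightarrow> 'a padic \<Rightarrow> 'a padic" where
  "x + y = Padic (\<lambda>n. padic_seq x n + padic_seq y n)"
definition uminus_padic :: "'a padic \<Rightarrow> 'a padic" where
  "- x = Padic (\<lambda>n. - padic_seq x n)"
definition minus_padic :: "'a padic \<Rightarrow> 'a padic \<Rightarrow> 'a padic" where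
  "x - y = x + - y" for x y :: "'a padic"
definition times_padic :: "'a padic \<Rightarrow> 'a padic \<Rightarrow> 'a padic" where
  "x * y = Padic (\<lambda>n. padic_seq x n * padic_seq y n)"
definition inverse_padic :: "'a padic \<Rightarrow> 'a padic" where
  "inverse x = (if x = 0 then 0 else Padic (\<lambda>n. inverse (padic_seq x n)))"
definition divide_padic :: "'a padic \<Rightarrow> 'a padic \<Rightarrow> 'a padic" where
  "x div y = x * inverse y" for x y :: "'a padic"

lemma add_Padic:
  assumes "padic_cauchy CARD('a) X" "padic_cauchy CARD('a) Y"
  shows "(Padic X :: 'a padic) + Padic Y = Padic (\<lambda>n. X n + Y n)"
  using padic_null_add[OF prime_card padic_null_seq_Padic[OF assms(1)] padic_null_seq_Padic[OF assms(2)]] assms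
  by (simp add: plus_padic_def Padic_eq_iff add_diff_add)

lemma minus_Padic:
  assumes "padic_cauchy CARD('a) X"
  shows "- (Padic X :: 'a padic) = Padic (\<lambda>n. - X n)"
  using padic_null_minus[OF prime_card padic_null_seq_Padic[OF assms(1)]] assms
  by (simp add: uminus_padic_def Padic_eq_iff)

lemma diff_Padic:
  assumes "padic_cauchy CARD('a) X" "padic_cauchy CARD('a) Y"
  shows "(Padic X :: 'a padic) - Padic Y = Padic (\<lambda>n. X n - Y n)"
  using assms by (simp add: minus_padic_def minus_Padic add_Padic)

lemma mult_Padic:
  assumes "padic_cauchy CARD('a) X" "padic_cauchy CARD('a) Y"
  shows "(Padic X :: 'a padic) * Padic Y = Padic (\<lambda>n. X n * Y n)"
proof -
  let ?X = "padic_seq (Padic X :: 'a padic)" and ?Y = "padic_seq (Padic Y :: 'a padic)"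
  have "padic_null CARD('a) (\<lambda>n. ?X n * (?Y n - Y n) + Y n * (?X n - X n))"
    using assms
    by (intro padic_null_add[OF prime_card] padic_null_mult_bounded[OF prime_card] padic_null_seq_Padic) auto
  then show ?thesis
    using assms by (simp add: times_padic_def Padic_eq_iff algebra_simps)
qed

lemma Padic_eq_0_iff:
  assumes "padic_cauchy CARD('a) X"
  shows "(Padic X :: 'a padic) = 0 \<longleftrightarrow> padic_null CARD('a) X"
  using assms by (simp add: zero_padic_def Padic_eq_iff)

instance
proof
  fix a b c :: "'a padic"
  obtain X Y Z where [simp]: "a = Padic X" "b = Padic Y" "c = Padic Z" and
    [simp]: "padic_cauchy CARD('a) X" "padic_cauchy CARD('a) Y" "padic_cauchy CARD('a) Z"
    by (metis padic_cases)
  note [simp] = add_Padic mult_Padic minus_Padic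
  show "a + b = b + a" by (simp add: ac_simps)
  show "(a + b) + c = a + (b + c)" by (simp add: ac_simps)
  show "0 + a = a" by (simp add: zero_padic_def)
  show "- a + a = 0" by (simp add: zero_padic_def)
  show "a - b = a + - b" by (simp only: minus_padic_def)
  show "(a * b) * c = a * (b * c)" by (simp add: ac_simps)
  show "a * b = b * a" by (simp add: ac_simps)
  show "1 * a = a" by (simp add: one_padic_def)
  show "(a + b) * c = a * c + b * c" by (simp add: distrib_right)
  show "(0::'a padic) \<noteq> 1" by (simp add: zero_padic_def one_padic_def Padic_eq_iff)
  show "a div b = a * inverse b" by (simp only: divide_padic_def)
  show "inverse (0::'a padic) = 0" by (simp add: inverse_padic_def)
  show "inverse a * a = 1" if "a \<noteq> 0"
  proof -
    have nn: "\<not> padic_null CARD('a) (padic_seq a)"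
      using that Padic_eq_0_iff[of "padic_seq a"] by auto
    have c: "padic_cauchy CARD('a) (\<lambda>n. inverse (padic_seq a n))"
      by (rule padic_cauchy_inverse[OF prime_card padic_seq_cauchy nn])
    have "inverse a * a = Padic (\<lambda>n. inverse (padic_seq a n)) * Padic (padic_seq a)"
      unfolding inverse_padic_def Padic_padic_seq using that by (simp only: if_False)
    also have "\<dots> = Padic (\<lambda>n. inverse (padic_seq a n) * padic_seq a n)"
      by (rule mult_Padic[OF c padic_seq_cauchy])
    also have "\<dots> = 1"
      using padic_null_inverse_mult[OF prime_card padic_seq_cauchy nn] padic_cauchy_mult[OF prime_card c padic_seq_cauchy]
      unfolding one_padic_def by (subst Padic_eq_iff) auto
    finally show ?thesis .
  qed
qed

end

lemma of_nat_padic: "(of_nat k :: 'p::prime_card padic) = Padic (\<lambda>n. of_nat k)"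
  by (induction k) (simp_all add: zero_padic_def one_padic_def add_Padic)

instance padic :: (prime_card) field_char_0
proof
  show "inj (of_nat :: nat \<Rightarrow> 'a padic)"
    by (rule injI) (simp add: of_nat_padic Padic_eq_iff)
qed

definition padic_norm :: "'p::prime_card padic \<Rightarrow> real" where
  "padic_norm x = lim (\<lambda>n. rat_padic_abs CARD('p) (padic_seq x n))"

lemma tendsto_padic_norm_Padic:
  assumes "padic_cauchy CARD('p) X"
  shows "(\<lambda>n. rat_padic_abs CARD('p) (X n)) \<longlonglongrightarrow> padic_norm (Padic X :: 'p::prime_card padic)"
proof -
  let ?p = "CARD('p)" and ?Y = "padic_seq (Padic X :: 'p padic)"
  have Y: "(\<lambda>n. rat_padic_abs ?p (?Y n)) \<longlonglongrightarrow> padic_norm (Padic X :: 'p padic)"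
    unfolding padic_norm_def
    using padic_cauchy_abs_convergent[OF prime_card padic_seq_cauchy] by (simp add: convergent_LIMSEQ_iff)
  have "(\<lambda>n. rat_padic_abs ?p (X n) - rat_padic_abs ?p (?Y n)) \<longlonglongrightarrow> 0"
    using padic_null_seq_Padic[OF assms] unfolding padic_null_def
    by (rule Lim_null_comparison[rotated])
      (auto intro!: always_eventually simp: rat_padic_abs_commute[of _ "?Y _"] rat_padic_abs_triangle_diff[OF prime_card])
  from tendsto_add[OF this Y] show ?thesis by simp
qed

lemma padic_norm_Padic_const [simp]: "padic_norm (Padic (\<lambda>n. r) :: 'p::prime_card padic) = rat_padic_abs CARD('p) r"
  using tendsto_padic_norm_Padic[of "\<lambda>n. r", where 'p = 'p] by (simp add: LIMSEQ_const_iff)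

lemma padic_norm_nonneg: "0 \<le> padic_norm (x :: 'p::prime_card padic)"
proof (cases x)
  case (1 X)
  show ?thesis unfolding 1 by (rule LIMSEQ_le_const[OF tendsto_padic_norm_Padic[OF 1(2)]]) auto
qed

lemma padic_norm_eq_0_iff [simp]: "padic_norm (x :: 'p::prime_card padic) = 0 \<longleftrightarrow> x = 0"
proof (cases x)
  case (1 X)
  show ?thesis
    using tendsto_padic_norm_Padic[OF 1(2)] LIMSEQ_unique
    by (auto simp: 1 Padic_eq_0_iff padic_null_def)
qed

lemma padic_norm_mult: "padic_norm (x * y :: 'p::prime_card padic) = padic_norm x * padic_norm y"
proof (cases x; cases y)
  fix X Y assume *: "x = Padic X" "padic_cauchy CARD('p) X" "y = Padic Y" "padic_cauchy CARD('p) Y"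
  have "(\<lambda>n. rat_padic_abs CARD('p) (X n * Y n)) \<longlonglongrightarrow> padic_norm x * padic_norm y"
    using tendsto_mult[OF tendsto_padic_norm_Padic[OF *(2)] tendsto_padic_norm_Padic[OF *(4)]] *
    by (simp add: rat_padic_abs_mult[OF prime_card])
  moreover have "(\<lambda>n. rat_padic_abs CARD('p) (X n * Y n)) \<longlonglongrightarrow> padic_norm (x * y)"
    using tendsto_padic_norm_Padic[of "\<lambda>n. X n * Y n", where 'p = 'p] * by (simp add: mult_Padic)
  ultimately show ?thesis by (rule LIMSEQ_unique[rotated])
qed

lemma padic_norm_ultrametric: "padic_norm (x + y :: 'p::prime_card padic) \<le> max (padic_norm x) (padic_norm y)"
proof (cases x; cases y)
  fix X Y assume *: "x = Padic X" "padic_cauchy CARD('p) X" "y = Padic Y" "padic_cauchy CARD('p) Y"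
  have 1: "(\<lambda>n. max (rat_padic_abs CARD('p) (X n)) (rat_padic_abs CARD('p) (Y n))) \<longlonglongrightarrow> max (padic_norm x) (padic_norm y)"
    using tendsto_max[OF tendsto_padic_norm_Padic[OF *(2)] tendsto_padic_norm_Padic[OF *(4)]] * by simp
  have 2: "(\<lambda>n. rat_padic_abs CARD('p) (X n + Y n)) \<longlonglongrightarrow> padic_norm (x + y)"
    using tendsto_padic_norm_Padic[of "\<lambda>n. X n + Y n", where 'p = 'p] * by (simp add: add_Padic)
  show ?thesis
    by (rule LIMSEQ_le[OF 2 1]) (auto simp: rat_padic_abs_ultrametric[OF prime_card])
qed

lemma padic_norm_minus [simp]: "padic_norm (- x :: 'p::prime_card padic) = padic_norm x"
proof (cases x)
  case (1 X)
  show ?thesis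
    using tendsto_padic_norm_Padic[OF 1(2)] tendsto_padic_norm_Padic[of "\<lambda>n. - X n", where 'p = 'p] 1
    by (auto simp: minus_Padic intro: LIMSEQ_unique)
qed

lemma padic_norm_triangle: "padic_norm (x + y :: 'p::prime_card padic) \<le> padic_norm x + padic_norm y"
  using padic_norm_ultrametric[of x y] padic_norm_nonneg[of x] padic_norm_nonneg[of y] by linarith

instantiation padic :: (prime_card) metric_space
begin

definition dist_padic :: "'a padic \<Rightarrow> 'a padic \<Rightarrow> real" where
  "dist x y = padic_norm (x - y)" for x y :: "'a padic"

definition uniformity_padic :: "('a padic \<times> 'a padic) filter" where
  "uniformity_padic = (INF e\<in>{0<..}. principal {(x, y). dist x y < e})"

definition open_padic :: "'a padic set \<Rightarrow> bool" where
  "open_padic U \<longleftrightarrow> (\<forall>x\<in>U. eventually (\<lambda>(x', y). x' = x \<longrightarrow> y \<in> U) uniformity)"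

instance
proof
  show "(uniformity :: ('a padic \<times> 'a padic) filter) = (INF e\<in>{0<..}. principal {(x, y). dist x y < e})"
    by (simp add: uniformity_padic_def)
  show "open U \<longleftrightarrow> (\<forall>x\<in>U. eventually (\<lambda>(x', y). x' = x \<longrightarrow> y \<in> U) uniformity)" for U :: "'a padic set"
    by (simp add: open_padic_def)
  fix x y z :: "'a padic"
  show "dist x y = 0 \<longleftrightarrow> x = y"
    by (simp add: dist_padic_def)
  have "padic_norm (z - y) = padic_norm (y - z)"
    using padic_norm_minus[of "z - y"] by simp
  then show "dist x y \<le> dist x z + dist y z"
    using padic_norm_triangle[of "x - z" "z - y"] by (simp add: dist_padic_def)
qed

end

lemma Padic_rat_approx:
  assumes X: "padic_cauchy CARD('p) X"
  shows "(\<lambda>k. Padic (\<lambda>n. X k)) \<longlonglongrightarrow> (Padic X :: 'p::prime_card padic)"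
proof (rule metric_LIMSEQ_I)
  fix e :: real assume "e > 0"
  then have "e / 2 > 0" by simp
  then obtain N where N: "\<And>m n. m \<ge> N \<Longrightarrow> n \<ge> N \<Longrightarrow> rat_padic_abs CARD('p) (X m - X n) < e / 2"
    using X unfolding padic_cauchy_def by meson
  have "dist (Padic (\<lambda>n. X k)) (Padic X :: 'p padic) < e" if "k \<ge> N" for k
  proof -
    have "(\<lambda>n. rat_padic_abs CARD('p) (X k - X n)) \<longlonglongrightarrow> dist (Padic (\<lambda>n. X k)) (Padic X :: 'p padic)"
      using tendsto_padic_norm_Padic[of "\<lambda>n. X k - X n", where 'p = 'p] X by (simp add: dist_padic_def diff_Padic)
    then have "dist (Padic (\<lambda>n. X k)) (Padic X :: 'p padic) \<le> e / 2"
      by (rule LIMSEQ_le_const2) (use N that in \<open>auto intro!: exI[of _ N] less_imp_le\<close>)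
    then show ?thesis using \<open>e > 0\<close> by linarith
  qed
  then show "\<exists>N. \<forall>k\<ge>N. dist (Padic (\<lambda>n. X k)) (Padic X :: 'p padic) < e" by blast
qed

lemma Padic_rat_dense:
  assumes "e > 0"
  obtains r where "dist (x :: 'p::prime_card padic) (Padic (\<lambda>n. r)) < e"
  using metric_LIMSEQ_D[OF Padic_rat_approx[OF padic_seq_cauchy[of x]] assms]
  by (metis Padic_padic_seq dist_commute order_refl)

instance padic :: (prime_card) complete_space
proof
  fix x :: "nat \<Rightarrow> 'a padic" assume x: "Cauchy x"
  have "\<exists>r. dist (x k) (Padic (\<lambda>n. r)) < inverse (real (Suc k))" for k
    by (rule Padic_rat_dense[of "inverse (real (Suc k))" "x k"]) auto
  then obtain r where r: "\<And>k. dist (x k) (Padic (\<lambda>n. r k)) < inverse (real (Suc k))"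
    by metis
  let ?c = "\<lambda>k. Padic (\<lambda>n. r k) :: 'a padic"
  have xr: "(\<lambda>k. dist (x k) (?c k)) \<longlonglongrightarrow> 0"
    by (rule tendsto_sandwich[OF _ _ tendsto_const LIMSEQ_inverse_real_of_nat])
      (auto intro!: always_eventually less_imp_le[OF r] simp del: of_nat_Suc)
  have "padic_cauchy CARD('a) r"
    unfolding padic_cauchy_def
  proof (intro allI impI)
    fix e :: real assume "e > 0"
    then have e: "e / 3 > 0" by simp
    obtain M where M: "\<And>m n. m \<ge> M \<Longrightarrow> n \<ge> M \<Longrightarrow> dist (x m) (x n) < e / 3"
      using metric_CauchyD[OF x e] by blast
    obtain N where N: "\<And>n. n \<ge> N \<Longrightarrow> dist (x n) (?c n) < e / 3"
      using order_tendstoD(2)[OF xr e] unfolding eventually_sequentially by blast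
    have "rat_padic_abs CARD('a) (r m - r n) < e" if "m \<ge> max M N" "n \<ge> max M N" for m n
    proof -
      have "dist (?c m) (?c n) \<le> dist (x m) (?c m) + dist (x m) (x n) + dist (x n) (?c n)"
        by metric
      also have "\<dots> < e" using M[of m n] N[of m] N[of n] that by auto
      finally show ?thesis by (simp add: dist_padic_def diff_Padic)
    qed
    then show "\<exists>N. \<forall>m\<ge>N. \<forall>n\<ge>N. rat_padic_abs CARD('a) (r m - r n) < e" by blast
  qed
  then have "?c \<longlonglongrightarrow> Padic r" by (rule Padic_rat_approx)
  then have c: "(\<lambda>k. dist (?c k) (Padic r)) \<longlonglongrightarrow> 0" by (rule tendsto_dist_iff[THEN iffD1])
  have "(\<lambda>k. dist (x k) (Padic r)) \<longlonglongrightarrow> 0"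
    by (rule tendsto_sandwich[OF _ _ tendsto_const])
      (use tendsto_add[OF xr c] in \<open>auto intro!: always_eventually dist_triangle\<close>)
  then show "convergent x"
    unfolding convergent_def by (intro exI) (rule tendsto_dist_iff[THEN iffD2])
qed

lemma of_rat_padic: "(of_rat r :: 'p::prime_card padic) = Padic (\<lambda>n. r)"
proof -
  have i: "(of_int k :: 'p padic) = Padic (\<lambda>n. of_int k)" for k
    by (cases k) (simp_all add: of_nat_padic minus_Padic one_padic_def diff_Padic)
  obtain a b where ab: "quotient_of r = (a, b)" by force
  have b: "b > 0" and r: "r = of_int a / of_int b"
    using quotient_of_denom_pos[OF ab] quotient_of_div[OF ab] by auto
  have "(of_rat r :: 'p padic) * of_int b = of_int a"
    using b by (simp add: r of_rat_divide)
  also have "\<dots> = Padic (\<lambda>n. r) * of_int b"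
    using b by (simp add: i mult_Padic r)
  finally show ?thesis using b by simp
qed

lemma padic_norm_of_rat: "padic_norm (of_rat r :: 'p::prime_card padic) = rat_padic_abs CARD('p) r"
  by (simp add: of_rat_padic)

lemma closure_range_of_rat_padic: "closure (range of_rat) = (UNIV :: 'p::prime_card padic set)"
proof -
  have "x \<in> closure (range of_rat)" for x :: "'p padic"
    unfolding closure_approachable using Padic_rat_dense by (metis dist_commute of_rat_padic rangeI)
  then show ?thesis by blast
qed

definition padic_ball :: "int \<Rightarrow> 'p::prime_card padic set" where
  "padic_ball \<gamma> = {x. padic_norm x \<le> real CARD('p) powi \<gamma>}"

section \<open>Haar measure and Lebesgue spaces\<close>

text \<open>A Haar measure on the additive group. No normalization is imposed.
  Regularity is not listed: every locally finite Borel measure on the \<open>p\<close>-adic field is regular,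
  as the space is locally compact and second countable.\<close>

definition haar_measure :: "'a::{topological_space, group_add} measure \<Rightarrow> bool" where
  "haar_measure M \<longleftrightarrow>
     sets M = sets borel \<and>
     (\<forall>K. compact K \<longrightarrow> emeasure M K < \<infinity>) \<and>
     (\<forall>U. open U \<and> U \<noteq> {} \<longrightarrow> emeasure M U > 0) \<and>
     (\<forall>h. \<forall>A\<in>sets M. emeasure M ((\<lambda>x. h + x) ` A) = emeasure M A)"

definition Lq_norm :: "'a measure \<Rightarrow> ennreal \<Rightarrow> ('a \<Rightarrow> complex) \<Rightarrow> ennreal" where
  "Lq_norm M q f =
     (if q = \<infinity> then esssup M (\<lambda>x. ennreal (cmod (f x)))
      else let I = (\<integral>\<^sup>+ x. ennreal (cmod (f x) powr enn2real q) \<partial>M)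
           in if I = \<infinity> then \<infinity> else ennreal (enn2real I powr (1 / enn2real q)))"

definition Lq_space :: "'a measure \<Rightarrow> ennreal \<Rightarrow> ('a \<Rightarrow> complex) set" where
  "Lq_space M q = {f \<in> borel_measurable M. Lq_norm M q f < \<infinity>}"

section \<open>Smoothness\<close>

definition modulus_of_continuity ::
    "'p::prime_card padic measure \<Rightarrow> ennreal \<Rightarrow> ('p padic \<Rightarrow> complex) \<Rightarrow> nat \<Rightarrow> ennreal" where
  "modulus_of_continuity M q f n =
     (SUP h\<in>padic_ball (- int n). Lq_norm M q (\<lambda>x. f x - f (x - h)))"

definition Lip :: "real \<Rightarrow> 'p::prime_card padic measure \<Rightarrow> ennreal \<Rightarrow> ('p padic \<Rightarrow> complex) set" where
  "Lip \<alpha> M q = {f \<in> Lq_space M q.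
     \<exists>c>0. \<forall>n. modulus_of_continuity M q f n \<le> ennreal (c * real CARD('p) powr (- \<alpha> * real n))}"

definition critical_exponent :: "'p::prime_card padic measure \<Rightarrow> ennreal \<Rightarrow> ('p padic \<Rightarrow> complex) \<Rightarrow> ereal" where
  "critical_exponent M q f = (SUP \<nu>\<in>{\<nu>. f \<in> Lip \<nu> M q}. ereal \<nu>)"

definition locally_constant :: "('a::topological_space \<Rightarrow> 'b) \<Rightarrow> bool" where
  "locally_constant f \<longleftrightarrow> (\<forall>x. \<exists>U. open U \<and> x \<in> U \<and> (\<forall>y\<in>U. f y = f x))"

definition compactly_supported :: "('a::topological_space \<Rightarrow> 'b::zero) \<Rightarrow> bool" where
  "compactly_supported f \<longleftrightarrow> compact (closure {x. f x \<noteq> 0})"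

end

theory Submission
  imports Defs
begin

text \<open>By compactness of the support, a locally constant \<open>\<phi>\<close> is invariant under all
  translations by sufficiently small \<open>h\<close>, so its modulus of continuity vanishes for all
  \<open>n\<close> beyond some \<open>N\<close>. For the remaining \<open>n\<close> the modulus is bounded, since
  \<open>\<phi> - \<phi>(\<cdot> - h)\<close> is bounded and supported in the union of the support and its translate,
  whose measure does not depend on \<open>h\<close>.\<close>

lemma locally_constant_imp_continuous_on:
  fixes f :: "'a::topological_space \<Rightarrow> 'b::topological_space"
  assumes "locally_constant f"
  shows "continuous_on S f"
proof -
  have "(f \<longlongrightarrow> f x) (at x)" for x
  proof -
    obtain U where U: "open U" "x \<in> U" "\<forall>y\<in>U. f y = f x"
      using assms unfolding locally_constant_def by blast
    have "eventually (\<lambda>y. f y = f x) (at x)"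
      using U unfolding eventually_at_topological by blast
    then show ?thesis
      by (rule tendsto_eventually)
  qed
  then show ?thesis
    unfolding continuous_on_def by (blast intro: tendsto_within_subset[OF _ subset_UNIV])
qed

lemma compactly_supported_bounded:
  fixes f :: "'a::topological_space \<Rightarrow> 'b::real_normed_vector"
  assumes "continuous_on UNIV f" "compactly_supported f"
  obtains B where "0 \<le> B" "\<And>x. norm (f x) \<le> B"
proof -
  let ?K = "closure {x. f x \<noteq> 0}"
  have "compact (f ` ?K)"
    using continuous_on_subset[OF assms(1) subset_UNIV] assms(2)
    unfolding compactly_supported_def by (rule compact_continuous_image)
  then have "bounded (f ` ?K)"
    by (rule compact_imp_bounded)
  then obtain B where B: "0 < B" "\<And>x. x \<in> ?K \<Longrightarrow> norm (f x) \<le> B"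
    by (auto simp: bounded_pos)
  have "norm (f x) \<le> B" for x
  proof (cases "f x = 0")
    case False
    then have "x \<in> ?K" using closure_subset by fast
    then show ?thesis by (rule B(2))
  qed (use B(1) in simp)
  with B(1) show thesis
    by (intro that[of B]) auto
qed

text \<open>A Lebesgue number argument: the open sets on which \<open>f\<close> is constant cover
  the compact support, so some radius \<open>e\<close> puts the \<open>e\<close>-ball around each
  point of the support inside one of these sets.\<close>

lemma locally_constant_uniform:
  fixes f :: "'a::metric_space \<Rightarrow> 'b::zero"
  assumes lc: "locally_constant f" and cs: "compactly_supported f"
  obtains e where "e > 0" "\<And>x y. dist x y < e \<Longrightarrow> f x = f y"
proof -
  let ?K = "closure {x. f x \<noteq> 0}"
  have K: "compact ?K" using cs by (simp add: compactly_supported_def)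
  let ?C = "{U. open U \<and> (\<forall>x\<in>U. \<forall>y\<in>U. f x = f y)}"
  have cover: "?K \<subseteq> \<Union>?C"
  proof
    fix x
    obtain U where U: "open U" "x \<in> U" "\<forall>y\<in>U. f y = f x"
      using lc unfolding locally_constant_def by blast
    then have "\<forall>y\<in>U. \<forall>z\<in>U. f y = f z" by metis
    with U show "x \<in> \<Union>?C" by blast
  qed
  obtain e where e: "e > 0" "\<And>x. x \<in> ?K \<Longrightarrow> \<exists>U\<in>?C. ball x e \<subseteq> U"
    by (rule Heine_Borel_lemma[OF K cover]) blast+
  have *: "f x = f y" if "dist x y < e" "x \<in> ?K" for x y
  proof -
    obtain U where "U \<in> ?C" "ball x e \<subseteq> U" using e(2) \<open>x \<in> ?K\<close> by blast
    moreover have "x \<in> ball x e" "y \<in> ball x e" using that e(1) by auto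
    ultimately show ?thesis by blast
  qed
  \<comment> \<open>The ball must be centred in the support, so symmetry of \<open>dist\<close>
    covers the case where only \<open>y\<close> lies there. Two points outside the support share the
    value 0.\<close>
  have "f x = f y" if d: "dist x y < e" for x y
  proof (cases "x \<in> ?K \<or> y \<in> ?K")
    case True
    then show ?thesis using *[of x y] *[of y x] d by (metis dist_commute)
  next
    case False
    then have "f x = 0" "f y = 0"
      using closure_subset[of "{x. f x \<noteq> 0}"] by blast+
    then show ?thesis by simp
  qed
  with e(1) show thesis by (rule that)
qed

lemma Lq_norm_zero: "Lq_norm M q (\<lambda>x. 0) = 0"
proof -
  have "esssup M (\<lambda>x. 0 :: ennreal) \<le> 0"
    by (rule esssup_I) auto
  then show ?thesis by (simp add: Lq_norm_def)
qed

text \<open>The essential supremum is at most \<open>B\<close>, and for finite \<open>q\<close> the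
  integrand is dominated by \<open>B powr enn2real q\<close> on \<open>S\<close>. The
  \<open>max\<close> merges both cases into one real bound that sees \<open>f\<close> only through
  \<open>B\<close> and \<open>m\<close>, hence is uniform over translations. At infinity
  \<open>enn2real q\<close> is 0, and the second argument of \<open>max\<close> is a harmless junk
  value.\<close>

lemma Lq_norm_le_bounded_support:
  assumes f: "f \<in> borel_measurable M"
    and S: "S \<in> sets M" "emeasure M S \<le> ennreal m" and m: "0 \<le> m"
    and B: "0 \<le> B" "\<And>x. cmod (f x) \<le> B" and supp: "\<And>x. x \<notin> S \<Longrightarrow> f x = 0"
  shows "Lq_norm M q f \<le> ennreal (max B ((B powr enn2real q * m) powr (1 / enn2real q)))"
proof (cases "q = \<infinity>")
  case True
  have "esssup M (\<lambda>x. ennreal (cmod (f x))) \<le> ennreal B"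
    using f B by (intro esssup_I) (auto intro: ennreal_leI)
  also have "\<dots> \<le> ennreal (max B ((B powr enn2real q * m) powr (1 / enn2real q)))"
    by (intro ennreal_leI) simp
  finally show ?thesis using True by (simp add: Lq_norm_def)
next
  case False
  let ?r = "enn2real q"
  let ?I = "\<integral>\<^sup>+ x. ennreal (cmod (f x) powr ?r) \<partial>M"
  have "?I \<le> (\<integral>\<^sup>+ x. ennreal (B powr ?r) * indicator S x \<partial>M)"
  proof (rule nn_integral_mono)
    fix x
    \<comment> \<open>Off \<open>S\<close> the left side is \<open>0 powr ?r\<close>, which is 0
      even when the exponent is 0.\<close>
    show "ennreal (cmod (f x) powr ?r) \<le> ennreal (B powr ?r) * indicator S x"
      using B supp by (cases "x \<in> S") (simp_all add: ennreal_leI powr_mono2)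
  qed
  also have "\<dots> = ennreal (B powr ?r) * emeasure M S"
    using S by (simp add: nn_integral_cmult_indicator)
  also have "\<dots> \<le> ennreal (B powr ?r * m)"
    using S m by (simp add: ennreal_mult mult_left_mono)
  finally have I: "?I \<le> ennreal (B powr ?r * m)" .
  have fin: "?I \<noteq> \<infinity>"
    using le_less_trans[OF I ennreal_less_top] by simp
  have "enn2real ?I \<le> B powr ?r * m"
    using I m by (intro enn2real_leI) simp_all
  then have "enn2real ?I powr (1 / ?r) \<le> (B powr ?r * m) powr (1 / ?r)"
    by (intro powr_mono2) auto
  then have "ennreal (enn2real ?I powr (1 / ?r)) \<le> ennreal (max B ((B powr ?r * m) powr (1 / ?r)))"
    by (intro ennreal_leI) simp
  moreover have "Lq_norm M q f = ennreal (enn2real ?I powr (1 / ?r))"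
    unfolding Lq_norm_def Let_def if_not_P[OF False] if_not_P[OF fin] ..
  ultimately show ?thesis by (simp only:)
qed

lemma dist_add_left_padic: "dist (h + x) (h + y) = dist x (y :: 'p::prime_card padic)"
  by (simp add: dist_padic_def)

text \<open>Translations are isometries. Their continuity gives compactness of translated supports
  and measurability of translated functions.\<close>

lemma continuous_on_padic_translation: "continuous_on S (\<lambda>x. h + x :: 'p::prime_card padic)"
  by (auto simp: continuous_on_iff dist_add_left_padic)

lemma modulus_of_continuity_bounded:
  fixes f :: "'p::prime_card padic \<Rightarrow> complex"
  assumes M: "haar_measure M" and f: "continuous_on UNIV f" "compactly_supported f"
  obtains C where "0 \<le> C" "\<And>n. modulus_of_continuity M q f n \<le> ennreal C"
proof -
  obtain B where B: "0 \<le> B" "\<And>x. cmod (f x) \<le> B"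
    using compactly_supported_bounded[OF f] by blast
  let ?K = "closure {x. f x \<noteq> 0}"
  have K: "compact ?K" using f by (simp add: compactly_supported_def)
  have sets: "sets M = sets borel"
    and fin: "emeasure M ?K < \<infinity>"
    and inv: "\<And>h A. A \<in> sets M \<Longrightarrow> emeasure M ((\<lambda>x. h + x) ` A) = emeasure M A"
    using M K unfolding haar_measure_def by blast+
  \<comment> \<open>By subadditivity and translation invariance, \<open>m\<close> bounds the measure
    of the support united with any translate of it; \<open>2 * B\<close> bounds the difference
    pointwise. So \<open>C\<close> is independent of \<open>h\<close> and bounds the supremum over
    every ball.\<close>
  define m where "m = 2 * enn2real (emeasure M ?K)"
  define C where "C = max (2 * B) (((2 * B) powr enn2real q * m) powr (1 / enn2real q))"
  have "Lq_norm M q (\<lambda>x. f x - f (x - h)) \<le> ennreal C" for h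
    unfolding C_def
  proof (rule Lq_norm_le_bounded_support)
    let ?S = "?K \<union> (\<lambda>x. h + x) ` ?K"
    have hK: "compact ((\<lambda>x. h + x) ` ?K)"
      by (rule compact_continuous_image[OF continuous_on_padic_translation K])
    have KM: "?K \<in> sets M" "(\<lambda>x. h + x) ` ?K \<in> sets M"
      using hK by (auto simp: sets intro: borel_closed compact_imp_closed)
    then show "?S \<in> sets M" by blast
    have "emeasure M ?S \<le> emeasure M ?K + emeasure M ?K"
      using emeasure_subadditive[OF KM] inv[OF KM(1)] by simp
    also have "\<dots> = ennreal (enn2real (emeasure M ?K)) + ennreal (enn2real (emeasure M ?K))"
      using fin by simp
    also have "\<dots> = ennreal m"
      unfolding m_def mult_2 by (simp flip: ennreal_plus)
    finally show "emeasure M ?S \<le> ennreal m" .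
    show "0 \<le> m" by (simp add: m_def)
    show "0 \<le> 2 * B" using B by simp
    show "cmod (f x - f (x - h)) \<le> 2 * B" for x
      using norm_triangle_ineq4[of "f x" "f (x - h)"] B(2)[of x] B(2)[of "x - h"] by linarith
    show "f x - f (x - h) = 0" if "x \<notin> ?S" for x
    proof -
      have "x - h \<notin> ?K"
      proof
        assume "x - h \<in> ?K"
        then have "h + (x - h) \<in> (\<lambda>x. h + x) ` ?K" by (rule imageI)
        with that show False by simp
      qed
      then have "f x = 0" "f (x - h) = 0"
        using that closure_subset[of "{x. f x \<noteq> 0}"] by blast+
      then show ?thesis by simp
    qed
    \<comment> \<open>Writing \<open>x - h\<close> as \<open>- h + x\<close> exhibits the shifted
      function as \<open>f\<close> composed with a left translation.\<close>
    have "continuous_on UNIV (\<lambda>x. f (- h + x))"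
      by (rule continuous_on_compose2[OF f(1) continuous_on_padic_translation]) simp
    then have "continuous_on UNIV (\<lambda>x. f x - f (x - h))"
      using f(1) by (auto intro!: continuous_on_diff)
    then show "(\<lambda>x. f x - f (x - h)) \<in> borel_measurable M"
      using measurable_cong_sets[OF sets refl] borel_measurable_continuous_onI by blast
  qed
  then have "modulus_of_continuity M q f n \<le> ennreal C" for n
    unfolding modulus_of_continuity_def by (rule SUP_least)
  moreover have "0 \<le> C" using B by (simp add: C_def le_max_iff_disj)
  ultimately show thesis using that by blast
qed

text \<open>Subtracting \<open>h\<close> moves every point by exactly the norm of \<open>h\<close>.
  Once this is below the radius of uniform local constancy, the difference is the zero function and
  not merely small, which is why no exponent is excluded later.\<close>

lemma modulus_of_continuity_eventually_zero:
  fixes f :: "'p::prime_card padic \<Rightarrow> complex"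
  assumes "locally_constant f" "compactly_supported f"
  obtains N where "\<And>n. n \<ge> N \<Longrightarrow> modulus_of_continuity M q f n = 0"
proof -
  obtain e where e: "e > 0" "\<And>x y. dist x y < e \<Longrightarrow> f x = f y"
    using locally_constant_uniform[OF assms] by blast
  have p: "real CARD('p) > 1"
    using prime_gt_1_nat[OF prime_card[where 'a = 'p]] by simp
  obtain N where N: "inverse (real CARD('p)) ^ N < e"
    using real_arch_pow_inv[OF e(1), of "inverse (real CARD('p))"] p
    by (auto simp: inverse_less_1_iff)
  have "modulus_of_continuity M q f n = 0" if "n \<ge> N" for n
  proof -
    have inv: "f x - f (x - h) = 0" if h: "h \<in> padic_ball (- int n)" for x h :: "'p padic"
    proof -
      have "dist x (x - h) \<le> inverse (real CARD('p)) ^ n"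
        using h by (simp add: dist_padic_def padic_ball_def power_int_minus power_inverse)
      also have "\<dots> \<le> inverse (real CARD('p)) ^ N"
        using p \<open>n \<ge> N\<close> by (intro power_decreasing) (auto simp: inverse_le_1_iff)
      finally show ?thesis using N e(2)[of x "x - h"] by simp
    qed
    have "modulus_of_continuity M q f n \<le> 0"
      unfolding modulus_of_continuity_def by (rule SUP_least) (simp only: inv Lq_norm_zero order_refl)
    then show ?thesis by simp
  qed
  then show thesis by (rule that)
qed

lemma locally_constant_in_Lip:
  fixes f :: "'p::prime_card padic \<Rightarrow> complex"
  assumes M: "haar_measure M" and f: "f \<in> Lq_space M q" "locally_constant f" "compactly_supported f"
    and \<alpha>: "\<alpha> > 0"
  shows "f \<in> Lip \<alpha> M q"
proof -
  obtain C where C: "0 \<le> C" "\<And>n. modulus_of_continuity M q f n \<le> ennreal C"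
    using modulus_of_continuity_bounded[OF M locally_constant_imp_continuous_on[OF f(2)] f(3)]
    by blast
  obtain N where N: "\<And>n. n \<ge> N \<Longrightarrow> modulus_of_continuity M q f n = 0"
    using modulus_of_continuity_eventually_zero[OF f(2,3)] by blast
  let ?p = "real CARD('p)"
  have p: "?p > 1"
    using prime_gt_1_nat[OF prime_card[where 'a = 'p]] by simp
  \<comment> \<open>The power of \<open>?p\<close> offsets the decay up to \<open>n = N\<close>,
    leaving a factor at least 1 for \<open>n < N\<close>. Taking \<open>C + 1\<close> keeps
    \<open>?c\<close> positive when \<open>C = 0\<close>.\<close>
  let ?c = "(C + 1) * ?p powr (\<alpha> * real N)"
  have "modulus_of_continuity M q f n \<le> ennreal (?c * ?p powr (- \<alpha> * real n))" for n
  proof (cases "n \<ge> N")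
    case True
    then show ?thesis by (simp add: N)
  next
    case False
    have "1 \<le> ?p powr (\<alpha> * (real N - real n))"
      using p \<alpha> False by (intro ge_one_powr_ge_zero) auto
    then have "C * 1 \<le> (C + 1) * ?p powr (\<alpha> * (real N - real n))"
      using C(1) by (intro mult_mono) auto
    also have "\<dots> = ?c * ?p powr (- \<alpha> * real n)"
      by (simp add: right_diff_distrib powr_diff powr_minus divide_inverse)
    finally have "C \<le> ?c * ?p powr (- \<alpha> * real n)" by simp
    then show ?thesis by (rule order_trans[OF C(2) ennreal_leI])
  qed
  moreover have "?c > 0" using C(1) p by simp
  ultimately show ?thesis
    using f(1) unfolding Lip_def by blast
qed

theorem theorem5p3:
  fixes \<mu> :: "'p::prime_card padic measure"
    and q :: ennreal
    and \<phi> :: "'p padic \<Rightarrow> complex"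
  assumes "haar_measure \<mu>"
    and "1 \<le> q"
    and "\<phi> \<in> Lq_space \<mu> q"
    and "locally_constant \<phi>"
    and "compactly_supported \<phi>"
  shows "(\<forall>\<alpha>>0. \<phi> \<in> Lip \<alpha> \<mu> q) \<and> critical_exponent \<mu> q \<phi> = \<infinity>"
proof
  show *: "\<forall>\<alpha>>0. \<phi> \<in> Lip \<alpha> \<mu> q"
    using locally_constant_in_Lip assms by blast
  have "ereal B \<le> critical_exponent \<mu> q \<phi>" for B
  proof -
    \<comment> \<open>Membership in \<open>Lip\<close> is at hand for positive exponents only, so an
      arbitrary real \<open>B\<close> is first raised to \<open>max B 1\<close>.\<close>
    have "ereal B \<le> ereal (max B 1)" by simp
    also have "\<dots> \<le> critical_exponent \<mu> q \<phi>"
      unfolding critical_exponent_def using * by (intro SUP_upper) simp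
    finally show ?thesis .
  qed
  then show "critical_exponent \<mu> q \<phi> = \<infinity>"
    by (rule ereal_top)
qed

end
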